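(* Let $\varphi:\mathbb{R}^{q\times p}\to\mathbb{R}$ be a convex and Lipschitz continuous function. Then its Moreau envelope $\mathrm{env}_\varphi(\cdot,\cdot):\mathbb{R}^{q\times p}\times(0,+\infty)\to\mathbb{R}$ is a smooth approximation function of $\varphi$ (in the sense defined in the context).
   Context: The Moreau envelope is $\mathrm{env}_\varphi(Z,\mu):=\min_{Y\in\mathbb{R}^{q\times p}}\{\varphi(Y)+\frac1{2\mu}\|Y-Z\|_F^2\}$ for $\mu>0$, with $\|\cdot\|_F$ the Frobenius norm. Definition. A function $\tilde g:\mathbb{R}^{q\times p}\times(0,+\infty)\to\mathbb{R}$ is a smooth approximation function of a (nonsmooth, possibly nonconvex) function $g:\mathbb{R}^{q\times p}\to\mathbb{R}$ if: (i) $\lim_{(Z,\mu)\to(X,0^+)}\tilde g(Z,\mu)=g(X)$ for all $X$; (ii) if $g$ is convex, then for any fixed $\mu>0$, $\tilde g(\cdot,\mu)$ is convex; (iii) there exist constants $L>0$ and $L'\ge0$ such that for any $\mu>0$, $\tilde g(\cdot,\mu)$ is differentiable and $\nabla_X\tilde g(\cdot,\mu)$ is Lipschitz continuous with constant $L\mu^{-1}+L'$; (iv) there exists $\kappa>0$ such that $|\tilde g(X,\mu_1)-\tilde g(X,\mu_2)|\le\kappa|\mu_1-\mu_2|$ for all $X$ and all $\mu_1,\mu_2>0$; (v) $\{\lim_{(Z,\mu)\to(X,0^+)}\nabla_Z\tilde g(Z,\mu)\}\subseteq\partial g(X)$ for all $X$, where the left side is the set of all limits of $\nabla_Z\tilde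 g(Z_k,\mu_k)$ along sequences $Z_k\to X$, $\mu_k\downarrow0$ for which the limit exists, and $\partial g$ is the Clarke subdifferential (equal to the convex subdifferential when $g$ is convex). *)

theory Defs
  imports "HOL-Analysis.Analysis"
begin

text \<open>
  \<^typ>\<open>real ^ 'p ^ 'q\<close> is the space of matrices with \<open>q = CARD('q)\<close> rows and \<open>p = CARD('p)\<close>
  columns.  Its library norm and inner product are the Frobenius ones:
\<close>

lemma norm_matrix_eq_frobenius:
  fixes A :: "real ^ 'p ^ 'q"
  shows "norm A = sqrt (\<Sum>i\<in>UNIV. \<Sum>j\<in>UNIV. (A $ i $ j)\<^sup>2)"
  by (simp add: norm_vec_def L2_set_def sum_nonneg)

lemma inner_matrix_eq_frobenius:
  fixes A B :: "real ^ 'p ^ 'q"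
  shows "A \<bullet> B = (\<Sum>i\<in>UNIV. \<Sum>j\<in>UNIV. A $ i $ j * B $ i $ j)"
  by (simp add: inner_vec_def)

text \<open>
  The Moreau envelope is the minimum itself, i.e. the least element of the set of values,
  and not merely its infimum; the value is unspecified if the minimum is not attained.
\<close>

definition moreau_env :: "(real ^ 'p ^ 'q \<Rightarrow> real) \<Rightarrow> real ^ 'p ^ 'q \<Rightarrow> real \<Rightarrow> real" where
  "moreau_env \<phi> Z \<mu> =
     (LEAST v. v \<in> range (\<lambda>Y. \<phi> Y + 1 / (2 * \<mu>) * (norm (Y - Z))\<^sup>2))"

lemma moreau_env_eqI:
  assumes "\<And>Y. \<phi> Y0 + 1 / (2 * \<mu>) * (norm (Y0 - Z))\<^sup>2 \<le> \<phi> Y + 1 / (2 * \<mu>) * (norm (Y - Z))\<^sup>2"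
  shows "moreau_env \<phi> Z \<mu> = \<phi> Y0 + 1 / (2 * \<mu>) * (norm (Y0 - Z))\<^sup>2"
  unfolding moreau_env_def by (rule Least_equality) (use assms in auto)

definition gradient :: "('a::real_inner \<Rightarrow> real) \<Rightarrow> 'a \<Rightarrow> 'a" where
  "gradient f x = (THE D. GDERIV f x :> D)"

lemma gradient_eqI:
  assumes "GDERIV f x :> D"
  shows "gradient f x = D"
  unfolding gradient_def
proof (rule the_equality)
  fix E
  assume "GDERIV f x :> E"
  then have "(\<lambda>h. h \<bullet> E) = (\<lambda>h. h \<bullet> D)"
    using assms has_derivative_unique unfolding gderiv_def by blast
  then have "(E - D) \<bullet> (E - D) = 0"
    by (metis inner_diff_right diff_self)
  then show "E = D" by simp
qed (rule assms)

text \<open>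
  Clarke's generalized directional derivative
  \<open>g\<degree>(X; V) = limsup (g (Y + t V) - g Y) / t\<close> as \<open>Y\<close> tends to \<open>X\<close> and \<open>t\<close> decreases to \<open>0\<close>,
  taken in the extended reals (it is finite when \<open>g\<close> is Lipschitz near \<open>X\<close>),
  and the subdifferential it supports.
\<close>

definition clarke_dd :: "('a::real_inner \<Rightarrow> real) \<Rightarrow> 'a \<Rightarrow> 'a \<Rightarrow> ereal" where
  "clarke_dd g X V =
     Limsup (at (X, 0) within UNIV \<times> {0<..}) (\<lambda>(Y, t). ereal ((g (Y + t *\<^sub>R V) - g Y) / t))"

definition clarke_subdifferential :: "('a::real_inner \<Rightarrow> real) \<Rightarrow> 'a \<Rightarrow> 'a set" where
  "clarke_subdifferential g X = {G. \<forall>V. ereal (G \<bullet> V) \<le> clarke_dd g X V}"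

definition gradient_limits :: "('a::real_inner \<Rightarrow> real \<Rightarrow> real) \<Rightarrow> 'a \<Rightarrow> 'a set" where
  "gradient_limits h X =
     {G. \<exists>Z \<mu>. Z \<longlonglongrightarrow> X \<and> (\<forall>k. \<mu> k > 0) \<and> \<mu> \<longlonglongrightarrow> 0 \<and>
           (\<lambda>k. gradient (\<lambda>Y. h Y (\<mu> k)) (Z k)) \<longlonglongrightarrow> G}"

text \<open>Values of \<open>h\<close> at nonpositive \<open>\<mu>\<close> are never inspected.\<close>

definition smooth_approximation ::
  "(real ^ 'p ^ 'q \<Rightarrow> real \<Rightarrow> real) \<Rightarrow> (real ^ 'p ^ 'q \<Rightarrow> real) \<Rightarrow> bool" where
  "smooth_approximation h g \<longleftrightarrow>
     (\<forall>X. ((\<lambda>(Z, \<mu>). h Z \<mu>) \<longlongrightarrow> g X) (at (X, 0) within UNIV \<times> {0<..})) \<and>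
     (convex_on UNIV g \<longrightarrow> (\<forall>\<mu>>0. convex_on UNIV (\<lambda>X. h X \<mu>))) \<and>
     (\<exists>L>0. \<exists>L'\<ge>0. \<forall>\<mu>>0.
        (\<forall>X. (\<lambda>Z. h Z \<mu>) differentiable at X) \<and>
        (L * inverse \<mu> + L')-lipschitz_on UNIV (gradient (\<lambda>Z. h Z \<mu>))) \<and>
     (\<exists>\<kappa>>0. \<forall>X. \<forall>\<mu>1>0. \<forall>\<mu>2>0. \<bar>h X \<mu>1 - h X \<mu>2\<bar> \<le> \<kappa> * \<bar>\<mu>1 - \<mu>2\<bar>) \<and>
     (\<forall>X. gradient_limits h X \<subseteq> clarke_subdifferential g X)"

end

theory Submission
  imports Defs
begin

text \<open>
  Let \<open>P\<close> be the minimizer in the definition of \<open>env(Z, \<mu>)\<close> (the proximal point) and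
  \<open>G = (Z - P) / \<mu>\<close>.  Optimality of \<open>P\<close> says that \<open>G\<close> is a subgradient of \<open>\<phi>\<close> at \<open>P\<close>, so
  \<open>norm G\<close> is at most the Lipschitz constant \<open>C\<close> of \<open>\<phi>\<close>, uniformly in \<open>Z\<close> and \<open>\<mu>\<close>.

  By duality the envelope is \<open>env(Z, \<mu>) = sup\<^sub>G (G \<bullet> Z - \<phi>\<^sup>*(G) - \<mu>/2 * norm(G)\<^sup>2)\<close>, a supremum of
  functions that are affine in \<open>Z\<close> and \<open>\<mu>\<close> jointly, attained at the \<open>G\<close> above.  Hence
  \<open>(G, - norm(G)\<^sup>2 / 2)\<close> is a joint subgradient of the envelope at \<open>(Z, \<mu>)\<close>.  This inequality,
  \<open>moreau_env_joint_subgradient\<close>, is proved directly from the subgradient inequality at \<open>P\<close>,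
  and carries most of the result: freezing \<open>\<mu>\<close> it gives convexity in \<open>Z\<close>, and, together with the
  quadratic upper bound obtained by testing the minimum at the old proximal point,
  differentiability with gradient \<open>G\<close>; freezing \<open>Z\<close> and using \<open>norm G \<le> C\<close> it gives the
  Lipschitz estimate in \<open>\<mu>\<close>.  Lipschitz continuity of the gradient is monotonicity of
  subgradients.  Finally \<open>P = Z - \<mu> G\<close> tends to \<open>X\<close> as \<open>Z\<close> tends to \<open>X\<close> and \<open>\<mu>\<close> to \<open>0\<close>, so
  the subgradient inequality passes to the limit, and convex subgradients are Clarke
  subgradients.
\<close>

section \<open>Convex subgradients\<close>

lemma power2_norm_add:
  fixes a b :: "'a::real_inner"
  shows "(norm (a + b))\<^sup>2 = (norm a)\<^sup>2 + 2 * (a \<bullet> b) + (norm b)\<^sup>2"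
  by (simp add: power2_norm_eq_inner inner_add_left inner_add_right inner_commute)

text \<open>A function that has a supporting affine function everywhere is a supremum of affine
  functions.\<close>

lemma convex_on_UNIV_if_subgradients:
  fixes f :: "'a::real_inner \<Rightarrow> real"
  assumes "\<And>x y. f x + D x \<bullet> (y - x) \<le> f y"
  shows "convex_on UNIV f"
proof (rule convex_onI)
  fix t :: real and x y :: 'a
  assume t: "0 < t" "t < 1"
  define z where "z = (1 - t) *\<^sub>R x + t *\<^sub>R y"
  have "(1 - t) * (f z + D z \<bullet> (x - z)) + t * (f z + D z \<bullet> (y - z)) \<le> (1 - t) * f x + t * f y"
    using t assms by (intro add_mono mult_left_mono) auto
  moreover have "(1 - t) * (f z + D z \<bullet> (x - z)) + t * (f z + D z \<bullet> (y - z))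
      = f z + D z \<bullet> ((1 - t) *\<^sub>R x + t *\<^sub>R y - z)"
    by (simp add: inner_diff_right inner_add_right algebra_simps)
  ultimately show "f ((1 - t) *\<^sub>R x + t *\<^sub>R y) \<le> (1 - t) * f x + t * f y"
    by (simp add: z_def)
qed simp

lemma gderiv_if_quadratic_bounds:
  fixes f :: "'a::real_inner \<Rightarrow> real"
  assumes lower: "\<And>y. f x + D \<bullet> (y - x) \<le> f y"
    and upper: "\<And>y. f y \<le> f x + D \<bullet> (y - x) + K * (norm (y - x))\<^sup>2"
  shows "GDERIV f x :> D"
  unfolding gderiv_def has_derivative_at
proof (intro conjI)
  show "bounded_linear (\<lambda>h. h \<bullet> D)"
    by (rule bounded_linear_inner_left)
  have lim: "((\<lambda>h::'a. K * norm h) \<longlongrightarrow> 0) (at 0)"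
    by (rule tendsto_mult_right_zero[OF tendsto_norm_zero[OF tendsto_ident_at]])
  show "((\<lambda>h. norm (f (x + h) - f x - h \<bullet> D) / norm h) \<longlongrightarrow> 0) (at 0)"
  proof (rule tendsto_sandwich[OF _ _ tendsto_const lim])
    show "\<forall>\<^sub>F h in at 0. norm (f (x + h) - f x - h \<bullet> D) / norm h \<le> K * norm h"
    proof (rule eventually_mono[OF eventually_neq_at_within[of 0]])
      fix h :: 'a
      assume "h \<noteq> 0"
      then show "norm (f (x + h) - f x - h \<bullet> D) / norm h \<le> K * norm h"
        using lower[of "x + h"] upper[of "x + h"]
        by (simp add: divide_le_eq power2_eq_square inner_commute mult.assoc)
    qed
  qed simp
qed

text \<open>Along the constant base point \<open>X\<close> every difference quotient is already at least \<open>G \<bullet> V\<close>,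
  and the points \<open>(X, t)\<close> belong to the filter over which the limes superior is taken.\<close>

lemma subgradient_in_clarke_subdifferential:
  fixes g :: "'a::real_inner \<Rightarrow> real"
  assumes "\<And>Y. g X + G \<bullet> (Y - X) \<le> g Y"
  shows "G \<in> clarke_subdifferential g X"
  unfolding clarke_subdifferential_def clarke_dd_def Limsup_def
proof (clarsimp simp: le_INF_iff split_beta)
  fix V :: 'a and Q
  assume ev: "eventually Q (at (X, 0::real) within UNIV \<times> {0<..})"
  have "filterlim (\<lambda>t::real. (X, t)) (at (X, 0) within UNIV \<times> {0<..}) (at_right 0)"
    unfolding filterlim_at
    by (auto intro!: tendsto_eq_intros simp: eventually_at_filter)
  then have "\<forall>\<^sub>F t in at_right 0. Q (X, t)"
    using ev by (simp add: filterlim_iff)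
  then have "\<forall>\<^sub>F t in at_right (0::real). Q (X, t) \<and> 0 < t"
    by (simp add: eventually_conj_iff eventually_at_right_less)
  then obtain t where t: "Q (X, t)" "0 < t"
    using eventually_happens'[OF trivial_limit_at_right_real] by blast
  have "G \<bullet> V \<le> (g (X + t *\<^sub>R V) - g X) / t"
    using assms[of "X + t *\<^sub>R V"] t(2) by (simp add: le_divide_eq algebra_simps)
  then show "ereal (G \<bullet> V) \<le> (SUP z\<in>Collect Q. ereal ((g (fst z + snd z *\<^sub>R V) - g (fst z)) / snd z))"
    using t(1) by (intro SUP_upper2[of "(X, t)"]) auto
qed

section \<open>The proximal point and the subgradient it yields\<close>

definition prox :: "(real ^ 'p ^ 'q \<Rightarrow> real) \<Rightarrow> real \<Rightarrow> real ^ 'p ^ 'q \<Rightarrow> real ^ 'p ^ 'q" where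
  "prox \<phi> \<mu> Z = (SOME P. \<forall>Y. \<phi> P + 1 / (2 * \<mu>) * (norm (P - Z))\<^sup>2
                         \<le> \<phi> Y + 1 / (2 * \<mu>) * (norm (Y - Z))\<^sup>2)"

text \<open>The Yosida approximation of the subdifferential; it turns out to be the gradient of the
  envelope.\<close>

definition yosida :: "(real ^ 'p ^ 'q \<Rightarrow> real) \<Rightarrow> real \<Rightarrow> real ^ 'p ^ 'q \<Rightarrow> real ^ 'p ^ 'q" where
  "yosida \<phi> \<mu> Z = (1 / \<mu>) *\<^sub>R (Z - prox \<phi> \<mu> Z)"

lemma prox_eq: "\<mu> > 0 \<Longrightarrow> prox \<phi> \<mu> Z = Z - \<mu> *\<^sub>R yosida \<phi> \<mu> Z"
  by (simp add: yosida_def)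

context
  fixes \<phi> :: "real ^ 'p ^ 'q \<Rightarrow> real" and C :: real
  assumes convex: "convex_on UNIV \<phi>"
    and lipschitz: "C-lipschitz_on UNIV \<phi>"
begin

lemma lipschitz_le: "\<phi> X - \<phi> Y \<le> C * norm (X - Y)"
  using lipschitz_onD[OF lipschitz, of X Y] by (simp add: dist_norm)

lemma lipschitz_constant_nonneg: "0 \<le> C"
  using lipschitz by (rule lipschitz_on_nonneg)

text \<open>Linear decrease of \<open>\<phi>\<close> is beaten by the quadratic term: outside the ball of radius
  \<open>2 \<mu> C\<close> about \<open>Z\<close> the objective exceeds its value at \<open>Z\<close>, so compactness applies.\<close>

lemma prox_minimal:
  assumes "\<mu> > 0"
  shows "\<phi> (prox \<phi> \<mu> Z) + 1 / (2 * \<mu>) * (norm (prox \<phi> \<mu> Z - Z))\<^sup>2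
      \<le> \<phi> Y + 1 / (2 * \<mu>) * (norm (Y - Z))\<^sup>2"
proof -
  define F where "F Y = \<phi> Y + 1 / (2 * \<mu>) * (norm (Y - Z))\<^sup>2" for Y
  have "continuous_on (cball Z (2 * \<mu> * C)) F"
    unfolding F_def
    by (intro continuous_intros continuous_on_subset[OF lipschitz_on_continuous_on[OF lipschitz]]) auto
  moreover have "cball Z (2 * \<mu> * C) \<noteq> {}"
    using assms lipschitz_constant_nonneg by (simp add: mult_less_0_iff)
  ultimately obtain P where P: "\<And>Y. Y \<in> cball Z (2 * \<mu> * C) \<Longrightarrow> F P \<le> F Y"
    using continuous_attains_inf[OF compact_cball] by metis
  have "F P \<le> F Y" for Y
  proof (cases "Y \<in> cball Z (2 * \<mu> * C)")
    case False
    then have "2 * \<mu> * C \<le> norm (Y - Z)"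
      by (simp add: dist_norm norm_minus_commute)
    then have "(2 * \<mu> * C) * norm (Y - Z) \<le> (norm (Y - Z))\<^sup>2"
      by (simp add: power2_eq_square mult_right_mono)
    then have "C * norm (Y - Z) \<le> 1 / (2 * \<mu>) * (norm (Y - Z))\<^sup>2"
      using assms by (simp add: field_simps)
    then have "F Z \<le> F Y"
      using lipschitz_le[of Z Y] by (simp add: F_def norm_minus_commute)
    moreover have "F P \<le> F Z"
      using P assms lipschitz_constant_nonneg by simp
    ultimately show ?thesis by simp
  qed (rule P)
  then have "\<exists>P. \<forall>Y. F P \<le> F Y" by blast
  then have "\<forall>Y. F (prox \<phi> \<mu> Z) \<le> F Y"
    unfolding prox_def F_def by (rule someI_ex)
  then show ?thesis by (simp add: F_def)
qed

lemma moreau_env_le: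
  assumes "\<mu> > 0"
  shows "moreau_env \<phi> Z \<mu> \<le> \<phi> Y + 1 / (2 * \<mu>) * (norm (Y - Z))\<^sup>2"
  using moreau_env_eqI[OF prox_minimal[OF assms]] prox_minimal[OF assms] by simp

lemma moreau_env_eq:
  assumes "\<mu> > 0"
  shows "moreau_env \<phi> Z \<mu> = \<phi> (prox \<phi> \<mu> Z) + \<mu> / 2 * (norm (yosida \<phi> \<mu> Z))\<^sup>2"
proof -
  have "norm (prox \<phi> \<mu> Z - Z) = \<mu> * norm (yosida \<phi> \<mu> Z)"
    using assms by (simp add: prox_eq)
  then show ?thesis
    using assms
    by (simp add: moreau_env_eqI[OF prox_minimal[OF assms]] power_mult_distrib power2_eq_square)
qed

text \<open>Minimality of \<open>P = prox \<phi> \<mu> Z\<close> is tested on the segment from \<open>P\<close> to \<open>Y\<close>: after division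
  by the segment parameter \<open>t\<close>, the quadratic term contributes only its linearization at \<open>P\<close>
  and an error of order \<open>t\<close>.\<close>

lemma yosida_subgradient:
  assumes "\<mu> > 0"
  shows "\<phi> (prox \<phi> \<mu> Z) + yosida \<phi> \<mu> Z \<bullet> (Y - prox \<phi> \<mu> Z) \<le> \<phi> Y"
proof -
  define P where "P = prox \<phi> \<mu> Z"
  define G where "G = yosida \<phi> \<mu> Z"
  define E where "E = 1 / (2 * \<mu>) * (norm (Y - P))\<^sup>2"
  have bound: "\<phi> P + G \<bullet> (Y - P) \<le> \<phi> Y + t * E" if t: "0 < t" "t < 1" for t
  proof -
    have "\<phi> P + 1 / (2 * \<mu>) * (norm (P - Z))\<^sup>2
        \<le> \<phi> ((1 - t) *\<^sub>R P + t *\<^sub>R Y) + 1 / (2 * \<mu>) * (norm ((1 - t) *\<^sub>R P + t *\<^sub>R Y - Z))\<^sup>2"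
      unfolding P_def by (rule prox_minimal[OF assms])
    moreover have "\<phi> ((1 - t) *\<^sub>R P + t *\<^sub>R Y) \<le> (1 - t) * \<phi> P + t * \<phi> Y"
      using convex_onD[OF convex, of t P Y] t by simp
    moreover have "1 / (2 * \<mu>) * (norm ((1 - t) *\<^sub>R P + t *\<^sub>R Y - Z))\<^sup>2
        = 1 / (2 * \<mu>) * (norm (P - Z))\<^sup>2 - t * (G \<bullet> (Y - P)) + t * (t * E)"
    proof -
      have PZ: "P - Z = - \<mu> *\<^sub>R G"
        using assms by (simp add: P_def G_def prox_eq)
      have "(1 - t) *\<^sub>R P + t *\<^sub>R Y - Z = - \<mu> *\<^sub>R G + t *\<^sub>R (Y - P)"
        unfolding PZ[symmetric] by (simp add: algebra_simps)
      then have "(norm ((1 - t) *\<^sub>R P + t *\<^sub>R Y - Z))\<^sup>2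
          = (\<mu> * norm G)\<^sup>2 - 2 * (\<mu> * (t * (G \<bullet> (Y - P)))) + (t * norm (Y - P))\<^sup>2"
        using assms t by (simp only: power2_norm_add) (simp add: power_mult_distrib)
      then show ?thesis
        using assms by (simp add: PZ E_def power2_eq_square add_divide_distrib diff_divide_distrib)
    qed
    ultimately have "t * (\<phi> P + G \<bullet> (Y - P)) \<le> t * (\<phi> Y + t * E)"
      by (simp add: algebra_simps)
    then show ?thesis using t by simp
  qed
  have "((\<lambda>t. \<phi> Y + t * E) \<longlongrightarrow> \<phi> Y + 0 * E) (at_right 0)"
    by (intro tendsto_intros)
  moreover have "\<forall>\<^sub>F t in at_right (0::real). \<phi> P + G \<bullet> (Y - P) \<le> \<phi> Y + t * E"
    using bound by (auto simp: eventually_at_right_field intro!: exI[of _ 1])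
  ultimately have "\<phi> P + G \<bullet> (Y - P) \<le> \<phi> Y + 0 * E"
    by (intro tendsto_lowerbound) auto
  then show ?thesis by (simp add: P_def G_def)
qed

lemma norm_yosida_le:
  assumes "\<mu> > 0"
  shows "norm (yosida \<phi> \<mu> Z) \<le> C"
proof -
  define P where "P = prox \<phi> \<mu> Z"
  define G where "G = yosida \<phi> \<mu> Z"
  have "\<phi> P + G \<bullet> G \<le> \<phi> (P + G)"
    using yosida_subgradient[OF assms, of Z "P + G"] by (simp add: P_def G_def)
  then have "norm G * norm G \<le> C * norm G"
    using lipschitz_le[of "P + G" P] by (simp add: power2_norm_eq_inner[symmetric] power2_eq_square)
  then have "norm G \<le> C"
    using lipschitz_constant_nonneg by (cases "G = 0") auto
  then show ?thesis by (simp add: G_def)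
qed

text \<open>Subgradients of \<open>\<phi>\<close> are monotone in the proximal points; substituting
  \<open>prox \<phi> \<mu> Z = Z - \<mu> *\<^sub>R yosida \<phi> \<mu> Z\<close> turns this into cocoercivity in \<open>Z\<close>.\<close>

lemma yosida_lipschitz:
  assumes "\<mu> > 0"
  shows "(inverse \<mu>)-lipschitz_on UNIV (yosida \<phi> \<mu>)"
proof (rule lipschitz_onI)
  fix X Z :: "real ^ 'p ^ 'q"
  define D where "D = yosida \<phi> \<mu> X - yosida \<phi> \<mu> Z"
  have "0 \<le> D \<bullet> (prox \<phi> \<mu> X - prox \<phi> \<mu> Z)"
    using yosida_subgradient[OF assms, of X "prox \<phi> \<mu> Z"]
      yosida_subgradient[OF assms, of Z "prox \<phi> \<mu> X"]
    by (simp add: D_def inner_diff_left inner_diff_right)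
  also have "prox \<phi> \<mu> X - prox \<phi> \<mu> Z = (X - Z) - \<mu> *\<^sub>R D"
    using assms by (simp add: prox_eq D_def algebra_simps)
  finally have "\<mu> * (norm D)\<^sup>2 \<le> D \<bullet> (X - Z)"
    by (simp add: inner_diff_right power2_norm_eq_inner)
  also have "\<dots> \<le> norm D * norm (X - Z)"
    by (rule norm_cauchy_schwarz)
  finally have "\<mu> * norm D \<le> norm (X - Z)"
    by (cases "D = 0") (auto simp: power2_eq_square)
  then show "dist (yosida \<phi> \<mu> X) (yosida \<phi> \<mu> Z) \<le> inverse \<mu> * dist X Z"
    using assms by (simp add: dist_norm D_def field_simps)
qed (use assms in simp)

section \<open>Estimates for the envelope\<close>

text \<open>With \<open>G\<close>, \<open>G'\<close> the subgradients at the two proximal points, the subgradient inequality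
  for \<open>\<phi>\<close> leaves the gap \<open>\<nu> / 2 * (norm (G' - G))\<^sup>2\<close>, which is discarded.\<close>

lemma moreau_env_joint_subgradient:
  assumes "\<mu> > 0" "\<nu> > 0"
  shows "moreau_env \<phi> Z \<mu> + yosida \<phi> \<mu> Z \<bullet> (W - Z) - (norm (yosida \<phi> \<mu> Z))\<^sup>2 / 2 * (\<nu> - \<mu>)
      \<le> moreau_env \<phi> W \<nu>"
proof -
  define G where "G = yosida \<phi> \<mu> Z"
  define G' where "G' = yosida \<phi> \<nu> W"
  have "\<phi> (prox \<phi> \<mu> Z) + G \<bullet> ((W - \<nu> *\<^sub>R G') - (Z - \<mu> *\<^sub>R G)) \<le> \<phi> (prox \<phi> \<nu> W)"
    using yosida_subgradient[OF assms(1), of Z "prox \<phi> \<nu> W"] assms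
    by (simp add: G_def G'_def prox_eq)
  moreover have "0 \<le> \<nu> / 2 * (norm (G' - G))\<^sup>2"
    using assms by simp
  ultimately show ?thesis
    unfolding moreau_env_eq[OF assms(1)] moreau_env_eq[OF assms(2)] G_def[symmetric] G'_def[symmetric]
    by (simp add: power2_norm_eq_inner inner_diff_left inner_diff_right inner_add_right
        inner_commute[of G' G] field_simps)
qed

lemma moreau_env_convex:
  assumes "\<mu> > 0"
  shows "convex_on UNIV (\<lambda>Z. moreau_env \<phi> Z \<mu>)"
  by (rule convex_on_UNIV_if_subgradients[where D = "yosida \<phi> \<mu>"])
    (use moreau_env_joint_subgradient[OF assms assms] in simp)

text \<open>The proximal point of \<open>Z\<close> is a competitor in the minimum at every other \<open>W\<close>; this makes
  the supporting affine function tight up to second order.\<close>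

lemma moreau_env_gderiv:
  assumes "\<mu> > 0"
  shows "GDERIV (\<lambda>Z. moreau_env \<phi> Z \<mu>) Z :> yosida \<phi> \<mu> Z"
proof (rule gderiv_if_quadratic_bounds)
  fix W
  show "moreau_env \<phi> Z \<mu> + yosida \<phi> \<mu> Z \<bullet> (W - Z) \<le> moreau_env \<phi> W \<mu>"
    using moreau_env_joint_subgradient[OF assms assms, of Z W] by simp
  have "prox \<phi> \<mu> Z - W = - (\<mu> *\<^sub>R yosida \<phi> \<mu> Z + (W - Z))"
    using assms by (simp add: prox_eq)
  then have "norm (prox \<phi> \<mu> Z - W) = norm (\<mu> *\<^sub>R yosida \<phi> \<mu> Z + (W - Z))"
    by (simp only: norm_minus_cancel)
  then show "moreau_env \<phi> W \<mu>
      \<le> moreau_env \<phi> Z \<mu> + yosida \<phi> \<mu> Z \<bullet> (W - Z) + 1 / (2 * \<mu>) * (norm (W - Z))\<^sup>2"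
    using moreau_env_le[OF assms, of W "prox \<phi> \<mu> Z"] assms
    by (simp only: moreau_env_eq[OF assms, of Z] power2_norm_add)
      (simp add: power_mult_distrib add_divide_distrib power2_eq_square mult.left_commute)
qed

lemma moreau_env_lipschitz_param:
  assumes "\<mu> > 0" "\<nu> > 0"
  shows "\<bar>moreau_env \<phi> X \<mu> - moreau_env \<phi> X \<nu>\<bar> \<le> C\<^sup>2 / 2 * \<bar>\<mu> - \<nu>\<bar>"
proof -
  have one_sided: "moreau_env \<phi> X \<mu> - moreau_env \<phi> X \<nu> \<le> C\<^sup>2 / 2 * \<bar>\<mu> - \<nu>\<bar>"
    if "\<mu> > 0" "\<nu> > 0" for \<mu> \<nu>
  proof -
    define s where "s = (norm (yosida \<phi> \<mu> X))\<^sup>2 / 2"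
    have "0 \<le> s" "s \<le> C\<^sup>2 / 2"
      using norm_yosida_le[OF that(1)] by (auto simp: s_def power_mono)
    have "s * (\<nu> - \<mu>) \<le> s * \<bar>\<mu> - \<nu>\<bar>"
      using \<open>0 \<le> s\<close> by (intro mult_left_mono) auto
    also have "\<dots> \<le> C\<^sup>2 / 2 * \<bar>\<mu> - \<nu>\<bar>"
      using \<open>s \<le> C\<^sup>2 / 2\<close> by (intro mult_right_mono) auto
    finally show ?thesis
      using moreau_env_joint_subgradient[OF that, of X X] by (simp add: s_def)
  qed
  show ?thesis
    using one_sided[OF assms] one_sided[OF assms(2,1)]
    unfolding abs_minus_commute[of \<nu> \<mu>] by linarith
qed

lemma moreau_env_bounds:
  assumes "\<mu> > 0"
  shows "\<phi> Z - C\<^sup>2 * \<mu> \<le> moreau_env \<phi> Z \<mu>" "moreau_env \<phi> Z \<mu> \<le> \<phi> Z"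
proof -
  have "\<phi> Z - \<phi> (prox \<phi> \<mu> Z) \<le> C * (\<mu> * norm (yosida \<phi> \<mu> Z))"
    using lipschitz_le[of Z "prox \<phi> \<mu> Z"] assms by (simp add: prox_eq)
  also have "\<dots> \<le> C * (\<mu> * C)"
    using norm_yosida_le[OF assms] assms lipschitz_constant_nonneg by (intro mult_left_mono) auto
  finally have "\<phi> Z - C\<^sup>2 * \<mu> \<le> \<phi> (prox \<phi> \<mu> Z)"
    by (simp add: power2_eq_square mult_ac)
  also have "\<dots> \<le> moreau_env \<phi> Z \<mu>"
    using assms by (simp add: moreau_env_eq)
  finally show "\<phi> Z - C\<^sup>2 * \<mu> \<le> moreau_env \<phi> Z \<mu>" .
  show "moreau_env \<phi> Z \<mu> \<le> \<phi> Z"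
    using moreau_env_le[OF assms, of Z Z] by simp
qed

section \<open>Limits as the smoothing parameter vanishes\<close>

lemma moreau_env_tendsto:
  "((\<lambda>(Z, \<mu>). moreau_env \<phi> Z \<mu>) \<longlongrightarrow> \<phi> X) (at (X, 0) within UNIV \<times> {0<..})"
proof -
  let ?F = "at (X, 0::real) within UNIV \<times> {0<..}"
  have fst: "(fst \<longlongrightarrow> X) ?F" and snd: "(snd \<longlongrightarrow> 0) ?F"
    using tendsto_fst[OF tendsto_ident_at, of "(X, 0::real)" "UNIV \<times> {0<..}"]
      tendsto_snd[OF tendsto_ident_at, of "(X, 0::real)" "UNIV \<times> {0<..}"] by simp_all
  have "isCont \<phi> X"
    using lipschitz_on_continuous_on[OF lipschitz] by (simp add: continuous_on_eq_continuous_at)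
  then have upper: "((\<lambda>z. \<phi> (fst z)) \<longlongrightarrow> \<phi> X) ?F"
    using fst by (rule isCont_tendsto_compose)
  have "((\<lambda>z. \<phi> (fst z) - C\<^sup>2 * snd z) \<longlongrightarrow> \<phi> X - C\<^sup>2 * 0) ?F"
    using upper snd by (intro tendsto_intros)
  then have lower: "((\<lambda>z. \<phi> (fst z) - C\<^sup>2 * snd z) \<longlongrightarrow> \<phi> X) ?F"
    by simp
  have pos: "\<forall>\<^sub>F z in ?F. 0 < snd z"
    unfolding eventually_at_filter by (rule always_eventually) auto
  show ?thesis
    by (rule tendsto_sandwich[OF _ _ lower upper])
      (use pos in \<open>auto elim!: eventually_mono simp: split_beta moreau_env_bounds\<close>)
qed

text \<open>The proximal points converge to \<open>X\<close> along with the \<open>Z k\<close>, because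
  \<open>prox \<phi> (\<mu> k) (Z k) = Z k - \<mu> k *\<^sub>R yosida \<phi> (\<mu> k) (Z k)\<close>.\<close>

lemma yosida_limit_subgradient:
  assumes Z: "Z \<longlonglongrightarrow> X" and pos: "\<And>k. \<mu> k > 0" and \<mu>: "\<mu> \<longlonglongrightarrow> 0"
    and G: "(\<lambda>k. yosida \<phi> (\<mu> k) (Z k)) \<longlonglongrightarrow> G"
  shows "\<phi> X + G \<bullet> (Y - X) \<le> \<phi> Y"
proof -
  have "(\<lambda>k. Z k - \<mu> k *\<^sub>R yosida \<phi> (\<mu> k) (Z k)) \<longlonglongrightarrow> X - 0 *\<^sub>R G"
    using Z \<mu> G by (intro tendsto_intros)
  then have P: "(\<lambda>k. prox \<phi> (\<mu> k) (Z k)) \<longlonglongrightarrow> X"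
    using pos by (simp add: prox_eq)
  have "isCont \<phi> X"
    using lipschitz_on_continuous_on[OF lipschitz] by (simp add: continuous_on_eq_continuous_at)
  then have "(\<lambda>k. \<phi> (prox \<phi> (\<mu> k) (Z k)) + yosida \<phi> (\<mu> k) (Z k) \<bullet> (Y - prox \<phi> (\<mu> k) (Z k)))
      \<longlonglongrightarrow> \<phi> X + G \<bullet> (Y - X)"
    using P G by (intro tendsto_intros isCont_tendsto_compose[of X \<phi>])
  then show ?thesis
    by (rule LIMSEQ_le_const2) (use yosida_subgradient pos in blast)
qed

end

theorem mainTheorem4:
  fixes \<phi> :: "real ^ 'p ^ 'q \<Rightarrow> real"
  assumes "convex_on UNIV \<phi>"
    and "\<exists>C. C-lipschitz_on UNIV \<phi>"
  shows "smooth_approximation (moreau_env \<phi>) \<phi>"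
proof -
  obtain C where C: "C-lipschitz_on UNIV \<phi>"
    using assms(2) by blast
  note hyps = assms(1) C
  have gradient: "gradient (\<lambda>Z. moreau_env \<phi> Z \<mu>) = yosida \<phi> \<mu>" if "\<mu> > 0" for \<mu>
    by (rule ext, rule gradient_eqI, rule moreau_env_gderiv[OF hyps that])
  show ?thesis
    unfolding smooth_approximation_def
  proof (intro conjI allI impI)
    fix X
    show "((\<lambda>(Z, \<mu>). moreau_env \<phi> Z \<mu>) \<longlongrightarrow> \<phi> X) (at (X, 0) within UNIV \<times> {0<..})"
      by (rule moreau_env_tendsto[OF hyps])
  next
    fix \<mu> :: real
    assume "\<mu> > 0"
    then show "convex_on UNIV (\<lambda>X. moreau_env \<phi> X \<mu>)"
      by (rule moreau_env_convex[OF hyps])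
  next
    have "(\<forall>X. (\<lambda>Z. moreau_env \<phi> Z \<mu>) differentiable at X) \<and>
        (1 * inverse \<mu> + 0)-lipschitz_on UNIV (gradient (\<lambda>Z. moreau_env \<phi> Z \<mu>))" if "\<mu> > 0" for \<mu>
      using moreau_env_gderiv[OF hyps that] yosida_lipschitz[OF hyps that] gradient[OF that]
      by (auto simp: gderiv_def intro: differentiableI)
    then show "\<exists>L>0. \<exists>L'\<ge>0. \<forall>\<mu>>0.
        (\<forall>X. (\<lambda>Z. moreau_env \<phi> Z \<mu>) differentiable at X) \<and>
        (L * inverse \<mu> + L')-lipschitz_on UNIV (gradient (\<lambda>Z. moreau_env \<phi> Z \<mu>))"
      by (intro exI[of _ 1] exI[of _ 0] conjI) auto
  next
    \<comment> \<open>The summand \<open>1\<close> keeps the constant positive when \<open>C = 0\<close>.\<close>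
    have "\<bar>moreau_env \<phi> X \<mu> - moreau_env \<phi> X \<nu>\<bar> \<le> (C\<^sup>2 / 2 + 1) * \<bar>\<mu> - \<nu>\<bar>"
      if "\<mu> > 0" "\<nu> > 0" for X \<mu> \<nu>
      using moreau_env_lipschitz_param[OF hyps that, of X]
      unfolding distrib_right by (intro add_increasing2) auto
    moreover have "C\<^sup>2 / 2 + 1 > 0"
      by (simp add: add_nonneg_pos)
    ultimately show "\<exists>\<kappa>>0. \<forall>X. \<forall>\<mu>1>0. \<forall>\<mu>2>0.
        \<bar>moreau_env \<phi> X \<mu>1 - moreau_env \<phi> X \<mu>2\<bar> \<le> \<kappa> * \<bar>\<mu>1 - \<mu>2\<bar>"
      by blast
  next
    fix X
    show "gradient_limits (moreau_env \<phi>) X \<subseteq> clarke_subdifferential \<phi> X"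
    proof
      fix G
      assume "G \<in> gradient_limits (moreau_env \<phi>) X"
      then obtain Z \<mu> where lim: "Z \<longlonglongrightarrow> X" "\<And>k. \<mu> k > 0" "\<mu> \<longlonglongrightarrow> 0"
        "(\<lambda>k. gradient (\<lambda>Y. moreau_env \<phi> Y (\<mu> k)) (Z k)) \<longlonglongrightarrow> G"
        unfolding gradient_limits_def by blast
      then have "(\<lambda>k. yosida \<phi> (\<mu> k) (Z k)) \<longlonglongrightarrow> G"
        by (simp add: gradient)
      then show "G \<in> clarke_subdifferential \<phi> X"
        by (intro subgradient_in_clarke_subdifferential yosida_limit_subgradient[OF hyps lim(1-3)])
    qed
  qed
qed

end
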